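(* Let $A,C\in\mathbb{R}^{m\times n}$ and $B,D\in\mathbb{R}^{p\times q}$. If $$\sigma_{1}(C)\,\sigma_{1}(D)<\sigma_{\min}(A)\,\sigma_{\min}(B),$$ then for every $F\in\mathbb{R}^{m\times q}$ the equation $$AXB-|CXD|=F$$ has a unique solution $X\in\mathbb{R}^{n\times p}$.
   Context: $|M|$ denotes the entrywise absolute value of a real matrix $M$; $\sigma_1(\cdot)$ and $\sigma_{\min}(\cdot)$ denote the largest and the smallest singular value of a matrix, respectively. The equation $AXB-|CXD|=F$ is called the new Sylvester-like absolute value equation. The matrices are allowed to be square or rectangular.
   Formalization: The smallest singular value of a non-square matrix is taken to be 0, so the hypothesis forces A and B to be square; with min(m,n) singular values the claim fails, e.g. A=(1,0)^T, B=(1), C=0, D=0, and in every non-square case. *)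

theory Defs
  imports "HOL-Analysis.Analysis"
begin

(* An m x n real matrix has type real^'n^'m with CARD('m) = m and CARD('n) = n. *)

definition eigenvalue :: "real^'n^'n \<Rightarrow> real \<Rightarrow> bool" where
  "eigenvalue M c \<longleftrightarrow> (\<exists>v. v \<noteq> 0 \<and> M *v v = c *\<^sub>R v)"

(* Singular values are the nonnegative square roots of the eigenvalues of the two Gram matrices
   A^T A and A A^T.  If A is square these have the same eigenvalues, and this is the usual
   notion.  In general their nonzero eigenvalues agree, so the two Gram matrices can only differ
   in whether 0 occurs.

   Convention for m \<noteq> n: the larger Gram matrix is singular, so 0 is a singular value (the list
   of singular values is padded by zeros to length max m n instead of being cut at min m n).
   This does not affect the largest singular value; the smallest one is then 0.  With the list
   cut at min m n, the solvability criterion \<sigma>_1(C) \<sigma>_1(D) < \<sigma>_min(A) \<sigma>_min(B) would fail: for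
   C = 0, D = 0, B = (1), the equation AX = F is not always solvable if A is the column (1,0)^T
   and never uniquely solvable if A is the row (1,0), although \<sigma>_min(A) = 1 in both cases. *)
definition singular_values :: "real^'n^'m \<Rightarrow> real set" where
  "singular_values A =
     {s. 0 \<le> s \<and> (eigenvalue (transpose A ** A) (s\<^sup>2) \<or> eigenvalue (A ** transpose A) (s\<^sup>2))}"

(* The set of singular values is finite and nonempty, so Max and Min are attained. *)
definition sigma_max :: "real^'n^'m \<Rightarrow> real" where
  "sigma_max A = Max (singular_values A)"

definition sigma_min :: "real^'n^'m \<Rightarrow> real" where
  "sigma_min A = Min (singular_values A)"

(* The library's absolute value on vectors is componentwise, hence entrywise on matrices. *)
lemma abs_matrix_nth: "\<bar>M :: real^'n^'m\<bar> $ i $ j = \<bar>M $ i $ j\<bar>"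
  by (simp add: abs_vec_def)

end

theory Submission
  imports Defs
begin

text \<open>The extrema of the norm of M x over the unit sphere are singular values, because an extremal
  vector is an eigenvector of the Gram matrix. Hence multiplication by M, on either side, scales the
  Frobenius norm by a factor between the smallest and the largest singular value. Under the
  hypothesis, A and B are therefore invertible, and the equation is a fixed-point equation for a
  contraction with constant \<sigma>_1(C) \<sigma>_1(D) / (\<sigma>_min(A) \<sigma>_min(B)).\<close>

section \<open>Quadratic forms and eigenvectors of the Gram matrix\<close>

text \<open>A null vector minimizes the nonnegative form, so the derivative of the form at
  \<open>v\<close> vanishes in every direction; in the direction \<open>f v\<close> it is twice the
  squared norm of \<open>f v\<close>.\<close>

lemma nonneg_form_null_vector:
  fixes f :: "'a::real_inner \<Rightarrow> 'a"
  assumes lin: "linear f" and sym: "\<And>x y. f x \<bullet> y = x \<bullet> f y"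
    and nonneg: "\<And>x. 0 \<le> x \<bullet> f x" and null: "v \<bullet> f v = 0"
  shows "f v = 0"
proof (rule ccontr)
  assume nz: "f v \<noteq> 0"
  define w where "w = f v"
  define b where "b = w \<bullet> f w"
  define a where "a = w \<bullet> w"
  have a: "a > 0" using nz by (simp add: a_def w_def)
  have b: "b \<ge> 0" using nonneg by (simp add: b_def)
  have vw: "v \<bullet> f w = a" "w \<bullet> f v = a"
    using sym[of v w] by (simp_all add: a_def w_def)
  have "0 \<le> (v + t *\<^sub>R w) \<bullet> f (v + t *\<^sub>R w)" for t by (rule nonneg)
  also have "(v + t *\<^sub>R w) \<bullet> f (v + t *\<^sub>R w) = 2 * t * a + t\<^sup>2 * b" for t
    using null vw
    by (simp add: linear_add[OF lin] linear_cmul[OF lin] inner_add_left inner_add_right b_def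
        power2_eq_square algebra_simps)
  finally have "0 \<le> 2 * t * a + t\<^sup>2 * b" for t .
  \<comment> \<open>At \<open>t = - r\<close> the quadratic in \<open>t\<close> becomes
    \<open>- (r\<^sup>2 * (b + 2))\<close>, which is negative. The summand 1 keeps the denominator
    positive when \<open>b = 0\<close>.\<close>
  moreover define r where "r = a / (b + 1)"
  ultimately have "0 \<le> 2 * (- r) * a + (- r)\<^sup>2 * b" by blast
  moreover have r: "0 < r" "a = r * (b + 1)" using a b by (simp_all add: r_def)
  ultimately have "0 \<le> - (r\<^sup>2 * (b + 2))" by (simp add: algebra_simps power2_eq_square)
  moreover have "0 < r\<^sup>2 * (b + 2)" using r b by simp
  ultimately show False by linarith
qed

lemma gram_inner:
  fixes M :: "real^'n^'m"
  shows "((transpose M ** M) *v x) \<bullet> y = (M *v x) \<bullet> (M *v y)"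
  by (simp add: matrix_vector_mul_assoc[symmetric] dot_lmul_matrix[symmetric])

text \<open>The Gram matrix minus \<open>s\<^sup>2\<close> times the identity, multiplied by
  \<open>c\<close>, is positive semidefinite with null vector \<open>v\<close>, so \<open>v\<close>
  lies in its kernel. The factor \<open>c\<close> covers both extrema of the norm on the unit
  sphere: 1 for a minimum, -1 for a maximum.\<close>

lemma gram_eigenvalueI:
  fixes M :: "real^'n^'m" and c s :: real
  assumes v: "v \<noteq> 0" and c: "c \<noteq> 0"
    and form: "\<And>x. 0 \<le> c * ((norm (M *v x))\<^sup>2 - (s * norm x)\<^sup>2)"
    and null: "norm (M *v v) = s * norm v"
  shows "eigenvalue (transpose M ** M) (s\<^sup>2)"
proof -
  define f where "f x = c *\<^sub>R ((transpose M ** M) *v x - s\<^sup>2 *\<^sub>R x)" for x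
  have f_inner: "f x \<bullet> y = c * ((M *v x) \<bullet> (M *v y) - s\<^sup>2 * (x \<bullet> y))" for x y
    by (simp add: f_def inner_diff_left gram_inner)
  have form_eq: "x \<bullet> f x = c * ((norm (M *v x))\<^sup>2 - (s * norm x)\<^sup>2)" for x
    by (subst inner_commute) (simp add: f_inner power2_norm_eq_inner power_mult_distrib)
  have "f v = 0"
  proof (rule nonneg_form_null_vector[of f v])
    show "linear f"
      by (rule linearI) (simp_all add: f_def matrix_vector_right_distrib scaleR_right_distrib
          matrix_vector_mult_scaleR algebra_simps)
    show "f x \<bullet> y = x \<bullet> f y" for x y
      using f_inner[of x y] f_inner[of y x] by (simp add: inner_commute)
    show "0 \<le> x \<bullet> f x" for x using form by (simp add: form_eq)
    show "v \<bullet> f v = 0" using null by (simp add: form_eq)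
  qed
  then show ?thesis using v c by (auto simp: f_def eigenvalue_def)
qed

section \<open>Finiteness of the set of singular values\<close>

text \<open>Eigenvectors of a symmetric matrix for distinct eigenvalues are orthogonal. One chosen
  eigenvector per eigenvalue gives an independent set, hence a finite one.\<close>

lemma finite_eigenvalues:
  fixes G :: "real^'n^'n"
  assumes "transpose G = G"
  shows "finite {c. eigenvalue G c}"
proof -
  have sym: "(G *v x) \<bullet> y = x \<bullet> (G *v y)" for x y
    using assms by (metis dot_lmul_matrix inner_commute transpose_matrix_vector)
  define v where "v c = (SOME v. v \<noteq> 0 \<and> G *v v = c *\<^sub>R v)" for c
  have v: "v c \<noteq> 0" "G *v v c = c *\<^sub>R v c" if "eigenvalue G c" for c
    using someI_ex[of "\<lambda>v. v \<noteq> 0 \<and> G *v v = c *\<^sub>R v"] that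
    unfolding eigenvalue_def v_def by auto
  have orth: "v c \<bullet> v d = 0" if "eigenvalue G c" "eigenvalue G d" "c \<noteq> d" for c d
    using sym[of "v c" "v d"] v[OF that(1)] v[OF that(2)] that(3) by simp
  \<comment> \<open>If \<open>v c = v d\<close> with \<open>c\<close> and \<open>d\<close> distinct,
    then \<open>v c\<close> is orthogonal to itself, hence 0.\<close>
  have inj: "inj_on v {c. eigenvalue G c}"
    using orth v(1) by (intro inj_onI) (metis inner_eq_zero_iff mem_Collect_eq)
  have "pairwise orthogonal (v ` {c. eigenvalue G c})"
    using orth by (auto simp: pairwise_def orthogonal_def)
  moreover have "0 \<notin> v ` {c. eigenvalue G c}" using v(1) by auto
  ultimately have "finite (v ` {c. eigenvalue G c})"
    using pairwise_orthogonal_independent independent_imp_finite by blast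
  with inj show ?thesis by (simp add: finite_image_iff)
qed

lemma finite_singular_values: "finite (singular_values M)" for M :: "real^'n^'m"
proof -
  have "finite ({c. eigenvalue (transpose M ** M) c} \<union> {c. eigenvalue (M ** transpose M) c})"
    by (intro finite_UnI finite_eigenvalues) (simp_all add: matrix_transpose_mul)
  moreover have "singular_values M \<subseteq>
      sqrt ` ({c. eigenvalue (transpose M ** M) c} \<union> {c. eigenvalue (M ** transpose M) c})"
  proof
    fix s assume "s \<in> singular_values M"
    then show "s \<in> sqrt ` ({c. eigenvalue (transpose M ** M) c} \<union>
        {c. eigenvalue (M ** transpose M) c})"
      by (intro image_eqI[of _ _ "s\<^sup>2"]) (auto simp: singular_values_def)
  qed
  ultimately show ?thesis by (meson finite_imageI finite_subset)
qed

lemma singular_values_transpose: "singular_values (transpose M) = singular_values M"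
  by (auto simp: singular_values_def)

section \<open>Extremal stretching of vectors\<close>

lemma norm_mult_unit_vector:
  fixes M :: "real^'n^'m"
  shows "norm (M *v x) = norm (M *v (x /\<^sub>R norm x)) * norm x"
  by (cases "x = 0") (simp_all add: matrix_vector_mult_scaleR)

lemma sphere_vec: "compact (sphere (0 :: real^'n) 1)" "sphere (0 :: real^'n) 1 \<noteq> {}"
proof -
  show "sphere (0 :: real^'n) 1 \<noteq> {}"
    using vector_choose_size[of 1, where 'a = "real^'n"] by auto
qed simp

text \<open>By compactness the maximum \<open>s\<close> over the unit sphere is attained at some
  \<open>v\<close>, and homogeneity extends the bound to all \<open>x\<close>. The form
  \<open>(s * norm x)\<^sup>2 - (norm (M *v x))\<^sup>2\<close> is then nonnegative and vanishes at
  \<open>v\<close>.\<close>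

lemma singular_value_attaining_sup:
  fixes M :: "real^'n^'m"
  obtains s where "s \<in> singular_values M" "\<And>x. norm (M *v x) \<le> s * norm x"
proof -
  have "continuous_on (sphere 0 1) (\<lambda>x. norm (M *v x))" by (intro continuous_intros)
  then obtain v where "v \<in> sphere 0 1"
      and "\<forall>y\<in>sphere 0 1. norm (M *v y) \<le> norm (M *v v)"
    using continuous_attains_sup[OF sphere_vec] by blast
  then have v: "norm v = 1" "\<And>y. norm y = 1 \<Longrightarrow> norm (M *v y) \<le> norm (M *v v)"
    by simp_all
  define s where "s = norm (M *v v)"
  have bound: "norm (M *v x) \<le> s * norm x" for x
  proof (cases "x = 0")
    case False
    then show ?thesis
      using v(2)[of "x /\<^sub>R norm x"]
      by (subst norm_mult_unit_vector) (simp add: s_def mult_right_mono)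
  qed simp
  have "eigenvalue (transpose M ** M) (s\<^sup>2)"
    using v(1) bound by (intro gram_eigenvalueI[of v "-1"]) (auto simp: s_def intro!: power_mono)
  then have "s \<in> singular_values M" by (simp add: singular_values_def s_def)
  with bound show ?thesis by (rule that[rotated])
qed

lemma singular_value_attaining_inf:
  fixes M :: "real^'n^'m"
  obtains s where "s \<in> singular_values M" "\<And>x. s * norm x \<le> norm (M *v x)"
proof -
  have "continuous_on (sphere 0 1) (\<lambda>x. norm (M *v x))" by (intro continuous_intros)
  then obtain v where "v \<in> sphere 0 1"
      and "\<forall>y\<in>sphere 0 1. norm (M *v v) \<le> norm (M *v y)"
    using continuous_attains_inf[OF sphere_vec] by blast
  then have v: "norm v = 1" "\<And>y. norm y = 1 \<Longrightarrow> norm (M *v v) \<le> norm (M *v y)"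
    by simp_all
  define s where "s = norm (M *v v)"
  have bound: "s * norm x \<le> norm (M *v x)" for x
  proof (cases "x = 0")
    case False
    then show ?thesis
      using v(2)[of "x /\<^sub>R norm x"]
      by (subst norm_mult_unit_vector) (simp add: s_def mult_right_mono)
  qed simp
  have "eigenvalue (transpose M ** M) (s\<^sup>2)"
    using v(1) bound by (intro gram_eigenvalueI[of v 1]) (auto simp: s_def intro!: power_mono)
  then have "s \<in> singular_values M" by (simp add: singular_values_def s_def)
  with bound show ?thesis by (rule that[rotated])
qed

lemma sigma_max_transpose: "sigma_max (transpose M) = sigma_max M"
  by (simp add: sigma_max_def singular_values_transpose)

lemma sigma_min_transpose: "sigma_min (transpose M) = sigma_min M"
  by (simp add: sigma_min_def singular_values_transpose)

lemma norm_matrix_vector_le_sigma_max: "norm (M *v x) \<le> sigma_max M * norm x"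
  for M :: "real^'n^'m"
proof -
  obtain s where s: "s \<in> singular_values M" "norm (M *v x) \<le> s * norm x"
    by (rule singular_value_attaining_sup[of M]) blast
  then have "s \<le> sigma_max M" by (simp add: sigma_max_def finite_singular_values)
  then show ?thesis using s(2) by (meson mult_right_mono norm_ge_zero order_trans)
qed

lemma sigma_min_le_norm_matrix_vector: "sigma_min M * norm x \<le> norm (M *v x)"
  for M :: "real^'n^'m"
proof -
  obtain s where s: "s \<in> singular_values M" "s * norm x \<le> norm (M *v x)"
    by (rule singular_value_attaining_inf[of M]) blast
  \<comment> \<open>Only an inequality: if \<open>M\<close> has more rows than columns,
    \<open>s\<close> can be positive while \<open>sigma_min M\<close> is 0.\<close>
  then have "sigma_min M \<le> s" by (simp add: sigma_min_def finite_singular_values)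
  then show ?thesis using s(2) by (meson mult_right_mono norm_ge_zero order_trans)
qed

lemma sigma_nonneg:
  fixes M :: "real^'n^'m"
  shows "0 \<le> sigma_max M" "0 \<le> sigma_min M"
proof -
  have ne: "singular_values M \<noteq> {}"
    by (rule singular_value_attaining_sup[of M]) blast
  have "\<forall>s \<in> singular_values M. 0 \<le> s" by (simp add: singular_values_def)
  then show "0 \<le> sigma_max M" "0 \<le> sigma_min M"
    unfolding sigma_max_def sigma_min_def
    using Max_in[OF finite_singular_values ne] Min_in[OF finite_singular_values ne] by auto
qed

section \<open>Frobenius norm of matrix products\<close>

lemma matrix_diff_ldistrib: "A ** (X - Y) = A ** X - A ** Y" for A :: "real^'n^'m"
  by (simp add: vec_eq_iff matrix_matrix_mult_def sum_subtractf right_diff_distrib)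

lemma matrix_diff_rdistrib: "(X - Y) ** A = X ** A - Y ** A" for A :: "real^'n^'m"
  by (simp add: vec_eq_iff matrix_matrix_mult_def sum_subtractf left_diff_distrib)

lemma norm_matrix_eq: "norm X = sqrt (\<Sum>i\<in>UNIV. \<Sum>j\<in>UNIV. (X $ i $ j)\<^sup>2)"
  for X :: "real^'n^'m"
  by (simp add: norm_vec_def L2_set_def sum_nonneg)

lemma norm_transpose_matrix: "norm (transpose X) = norm X" for X :: "real^'n^'m"
  by (simp add: norm_matrix_eq transpose_def) (rule sum.swap)

lemma row_matrix_mult: "(X ** M) $ i = transpose M *v (X $ i)"
  for M :: "real^'n^'m"
  by (simp add: vec_eq_iff matrix_matrix_mult_def matrix_vector_mult_def transpose_def mult.commute)

text \<open>The Frobenius norm is the L2 norm of the row norms, and each row of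
  \<open>X ** M\<close> is \<open>transpose M\<close> applied to a row of \<open>X\<close>;
  transposing preserves singular values.\<close>

lemma norm_mult_right_le_sigma_max: "norm (X ** M) \<le> sigma_max M * norm X"
  for X :: "real^'m^'k" and M :: "real^'n^'m"
proof -
  have "norm ((X ** M) $ i) \<le> sigma_max M * norm (X $ i)" for i
    using norm_matrix_vector_le_sigma_max[of "transpose M"]
    by (simp add: row_matrix_mult sigma_max_transpose)
  then show ?thesis
    unfolding norm_vec_def[where 'b = 'k] L2_set_right_distrib[OF sigma_nonneg(1)]
    by (intro L2_set_mono) auto
qed

lemma sigma_min_le_norm_mult_right: "sigma_min M * norm X \<le> norm (X ** M)"
  for X :: "real^'m^'k" and M :: "real^'n^'m"
proof -
  have "sigma_min M * norm (X $ i) \<le> norm ((X ** M) $ i)" for i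
    using sigma_min_le_norm_matrix_vector[of "transpose M"]
    by (simp add: row_matrix_mult sigma_min_transpose)
  then show ?thesis
    unfolding norm_vec_def[where 'b = 'k] L2_set_right_distrib[OF sigma_nonneg(2)]
    by (intro L2_set_mono) (auto simp: sigma_nonneg)
qed

text \<open>Transposing turns left into right multiplication and preserves the Frobenius
  norm.\<close>

lemma norm_mult_left_le_sigma_max: "norm (M ** X) \<le> sigma_max M * norm X"
  for X :: "real^'k^'n" and M :: "real^'n^'m"
  using norm_mult_right_le_sigma_max[of "transpose X" "transpose M"]
  by (metis matrix_transpose_mul norm_transpose_matrix sigma_max_transpose)

lemma sigma_min_le_norm_mult_left: "sigma_min M * norm X \<le> norm (M ** X)"
  for X :: "real^'k^'n" and M :: "real^'n^'m"
  using sigma_min_le_norm_mult_right[of "transpose M" "transpose X"]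
  by (metis matrix_transpose_mul norm_transpose_matrix sigma_min_transpose)

lemma norm_mult_both_le_sigma_max: "norm (C ** X ** D) \<le> sigma_max C * sigma_max D * norm X"
  for C :: "real^'n^'m" and D :: "real^'q^'p"
proof -
  have "norm (C ** X ** D) \<le> sigma_max D * norm (C ** X)" by (rule norm_mult_right_le_sigma_max)
  also have "\<dots> \<le> sigma_max D * (sigma_max C * norm X)"
    by (intro mult_left_mono norm_mult_left_le_sigma_max sigma_nonneg)
  finally show ?thesis by (simp add: mult_ac)
qed

lemma sigma_min_le_norm_mult_both: "sigma_min A * sigma_min B * norm X \<le> norm (A ** X ** B)"
  for A :: "real^'n^'m" and B :: "real^'q^'p"
proof -
  have "sigma_min B * (sigma_min A * norm X) \<le> sigma_min B * norm (A ** X)"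
    by (intro mult_left_mono sigma_min_le_norm_mult_left sigma_nonneg)
  also have "\<dots> \<le> norm (A ** X ** B)" by (rule sigma_min_le_norm_mult_right)
  finally show ?thesis by (simp add: mult_ac)
qed

section \<open>One-sided inverses\<close>

lemma left_inverse_of_sigma_min_pos:
  fixes M :: "real^'n^'m"
  assumes "0 < sigma_min M"
  obtains Q where "Q ** M = mat 1"
proof -
  have "x = 0" if "M *v x = 0" for x
    using sigma_min_le_norm_matrix_vector[of M x] assms that by (simp add: mult_le_0_iff)
  then show ?thesis using that matrix_left_invertible_ker by blast
qed

text \<open>\<open>transpose M\<close> has the same \<open>sigma_min\<close>, because
  \<open>singular_values\<close> uses both Gram matrices; its left inverse transposes to a right
  inverse of \<open>M\<close>.\<close>

lemma right_inverse_of_sigma_min_pos: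
  fixes M :: "real^'n^'m"
  assumes "0 < sigma_min M"
  obtains P where "M ** P = mat 1"
proof -
  obtain Q where "Q ** transpose M = mat 1"
    using left_inverse_of_sigma_min_pos[of "transpose M"] assms
    by (auto simp: sigma_min_transpose)
  then have "M ** transpose Q = mat 1"
    by (metis matrix_transpose_mul transpose_mat transpose_transpose)
  then show ?thesis by (rule that)
qed

section \<open>The contraction and its fixed points\<close>

lemma norm_abs_matrix_diff_le: "norm (\<bar>Y\<bar> - \<bar>Z\<bar>) \<le> norm (Y - Z)" for Y Z :: "real^'n^'m"
  unfolding norm_vec_def[where 'b = 'm]
  by (intro L2_set_mono norm_le_componentwise_cart) (auto simp: abs_matrix_nth)

theorem theorem2p4:
  fixes A C :: "real^'n^'m" and B D :: "real^'q^'p"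
  assumes "sigma_max C * sigma_max D < sigma_min A * sigma_min B"
  shows "\<forall>F :: real^'q^'m. \<exists>!X :: real^'p^'n. A ** X ** B - \<bar>C ** X ** D\<bar> = F"
proof
  fix F :: "real^'q^'m"
  define a where "a = sigma_min A * sigma_min B"
  define c where "c = sigma_max C * sigma_max D"
  have c: "0 \<le> c" by (simp add: c_def sigma_nonneg)
  have ca: "c < a" using assms by (simp add: a_def c_def)
  then have a: "0 < a" using c by simp
  then have "0 < sigma_min A" "0 < sigma_min B"
    using sigma_nonneg(2)[of A] sigma_nonneg(2)[of B] by (auto simp: a_def zero_less_mult_iff)
  then obtain P Q where P: "A ** P = mat 1" and Q: "Q ** B = mat 1"
    using right_inverse_of_sigma_min_pos left_inverse_of_sigma_min_pos by metis
  \<comment> \<open>\<open>T X\<close> solves the linear equation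
    \<open>A ** Y ** B = \<bar>C ** X ** D\<bar> + F\<close> for \<open>Y\<close>: \<open>P\<close>
    cancels \<open>A\<close> on the left and \<open>Q\<close> cancels \<open>B\<close> on the
    right.\<close>
  define T where "T X = P ** (\<bar>C ** X ** D\<bar> + F) ** Q" for X
  have AT: "A ** T X ** B = \<bar>C ** X ** D\<bar> + F" for X
  proof -
    have "A ** T X ** B = (A ** P) ** (\<bar>C ** X ** D\<bar> + F) ** (Q ** B)"
      by (simp add: T_def matrix_mul_assoc)
    then show ?thesis by (simp add: P Q)
  qed
  have lower: "a * norm (X - Y) \<le> norm (A ** X ** B - A ** Y ** B)" for X Y
    using sigma_min_le_norm_mult_both[of A B "X - Y"]
    by (simp add: a_def matrix_diff_ldistrib matrix_diff_rdistrib)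
  have upper: "norm (C ** X ** D - C ** Y ** D) \<le> c * norm (X - Y)" for X Y
    using norm_mult_both_le_sigma_max[of C "X - Y" D]
    by (simp add: c_def matrix_diff_ldistrib matrix_diff_rdistrib)
  have "\<exists>!X. T X = X"
  proof (rule banach_fix_type)
    show "0 \<le> c / a" "c / a < 1" using c ca a by simp_all
    show "\<forall>X Y. dist (T X) (T Y) \<le> c / a * dist X Y"
    proof (intro allI)
      fix X Y
      have "a * norm (T X - T Y) \<le> norm (\<bar>C ** X ** D\<bar> - \<bar>C ** Y ** D\<bar>)"
        using lower[of "T X" "T Y"] by (simp add: AT)
      also have "\<dots> \<le> c * norm (X - Y)"
        using norm_abs_matrix_diff_le upper order_trans by blast
      finally show "dist (T X) (T Y) \<le> c / a * dist X Y"
        using a by (simp add: dist_norm field_simps)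
    qed
  qed
  moreover have "A ** X ** B - \<bar>C ** X ** D\<bar> = F \<longleftrightarrow> T X = X" for X
  proof
    assume "A ** X ** B - \<bar>C ** X ** D\<bar> = F"
    then have "A ** T X ** B = A ** X ** B" by (simp add: AT algebra_simps)
    \<comment> \<open>Since \<open>a\<close> is positive, \<open>lower\<close> makes the map from
      \<open>X\<close> to \<open>A ** X ** B\<close> injective.\<close>
    then show "T X = X" using lower[of "T X" X] a by (simp add: mult_le_0_iff)
  next
    assume "T X = X"
    then show "A ** X ** B - \<bar>C ** X ** D\<bar> = F" using AT[of X] by simp
  qed
  ultimately show "\<exists>!X :: real^'p^'n. A ** X ** B - \<bar>C ** X ** D\<bar> = F" by simp
qed

end
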